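(* Let $p,q\ge 1$ be real numbers. There is a constant $C=C(p,q)>0$, depending only on $p$ and $q$, such that the following holds. Let $\Omega\subseteq\mathbb{R}^d$ be a bounded Borel set, let $\varrho$ be a Borel probability measure on $\Omega$, let $f,g$ be real-valued functions continuous on the closure $\bar\Omega$ with $f,g\in L^\infty(\Omega,\varrho)\cap L^p(\Omega,\varrho)$, and let $\mu=f_*\varrho$ and $\nu=g_*\varrho$. Then $$W_p(\mu,\nu)\le C\,\|f-g\|_{L^\infty(\Omega,\varrho)}^{\frac{p}{q+p}}\;\|f-g\|_{L^q(\Omega,\varrho)}^{\frac{q}{q+p}}.$$
   Context: The pushforward is $f_*\varrho(B)=\varrho(f^{-1}(B))$ for Borel $B\subseteq\mathbb{R}$. For Borel probability measures $\mu,\nu$ on $\mathbb{R}$ with finite $p$-th moments, $1\le p<\infty$, the Wasserstein distance is $W_p(\mu,\nu)=\left[\inf_{\gamma\in\Gamma}\int_{\mathbb{R}^2}|x-y|^p\,d\gamma(x,y)\right]^{1/p}$, where $\Gamma$ is the set of Borel measures on $\mathbb{R}^2$ whose first and second marginals are $\mu$ and $\nu$. *)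

theory Defs
  imports "HOL-Probability.Probability"
begin

(* Euclidean d-space is taken as the library topology Euclidean_space d, carried by the
   sequences nat => real that vanish from index d on, so that the dimension d is a number and
   not a type: a constant can then be quantified before d. *)

definition euclidean_borel :: "nat \<Rightarrow> (nat \<Rightarrow> real) measure" where
  "euclidean_borel d = sigma (topspace (Euclidean_space d)) {U. openin (Euclidean_space d) U}"

definition euclidean_norm :: "nat \<Rightarrow> (nat \<Rightarrow> real) \<Rightarrow> real" where
  "euclidean_norm d x = sqrt (\<Sum>i<d. (x i)\<^sup>2)"

definition euclidean_bounded :: "nat \<Rightarrow> (nat \<Rightarrow> real) set \<Rightarrow> bool" where
  "euclidean_bounded d S \<longleftrightarrow> (\<exists>B. \<forall>x\<in>S. euclidean_norm d x \<le> B)"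

(* Real power on [0,\<infinity>]; the value at \<infinity> is meant for exponents a > 0, the only ones used. *)
definition epowr :: "ennreal \<Rightarrow> real \<Rightarrow> ennreal" where
  "epowr x a = (if x = \<infinity> then \<infinity> else ennreal (enn2real x powr a))"

definition Lp_norm :: "'a measure \<Rightarrow> real \<Rightarrow> ('a \<Rightarrow> real) \<Rightarrow> ennreal" where
  "Lp_norm M p h = epowr (\<integral>\<^sup>+x. ennreal (\<bar>h x\<bar> powr p) \<partial>M) (1 / p)"

definition Linf_norm :: "'a measure \<Rightarrow> ('a \<Rightarrow> real) \<Rightarrow> ennreal" where
  "Linf_norm M h = esssup M (\<lambda>x. ennreal \<bar>h x\<bar>)"

definition in_Lp :: "'a measure \<Rightarrow> real \<Rightarrow> ('a \<Rightarrow> real) \<Rightarrow> bool" where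
  "in_Lp M p h \<longleftrightarrow> h \<in> borel_measurable M \<and> Lp_norm M p h < \<infinity>"

definition in_Linf :: "'a measure \<Rightarrow> ('a \<Rightarrow> real) \<Rightarrow> bool" where
  "in_Linf M h \<longleftrightarrow> h \<in> borel_measurable M \<and> Linf_norm M h < \<infinity>"

definition couplings :: "real measure \<Rightarrow> real measure \<Rightarrow> (real \<times> real) measure set" where
  "couplings \<mu> \<nu> = {\<gamma>. sets \<gamma> = sets borel \<and> distr \<gamma> borel fst = \<mu> \<and> distr \<gamma> borel snd = \<nu>}"

(* Valued in [0,\<infinity>], so that an upper bound by a finite quantity includes finiteness.
   Meant for Borel probability measures with finite p-th moments and p \<ge> 1. *)
definition wasserstein :: "real \<Rightarrow> real measure \<Rightarrow> real measure \<Rightarrow> ennreal" where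
  "wasserstein p \<mu> \<nu> =
     epowr (INF \<gamma>\<in>couplings \<mu> \<nu>. \<integral>\<^sup>+z. ennreal (\<bar>fst z - snd z\<bar> powr p) \<partial>\<gamma>) (1 / p)"

end

theory Submission
  imports Defs
begin

text \<open>
  The image of \<open>\<rho>\<close> under \<open>x \<mapsto> (f x, g x)\<close> is a coupling, so \<open>W\<^sub>p(\<mu>, \<nu>) \<le> \<parallel>h\<parallel>\<^sub>p\<close> for \<open>h = f - g\<close>.
  On a probability space \<open>\<parallel>h\<parallel>\<^sub>p \<le> \<parallel>h\<parallel>\<^bsub>p+q\<^esub>\<close> by Jensen, and
  \<open>\<bar>h\<bar>\<^bsup>p+q\<^esup> \<le> \<parallel>h\<parallel>\<^sub>\<infinity>\<^bsup>p\<^esup> \<bar>h\<bar>\<^bsup>q\<^esup>\<close> almost everywhere; hence \<open>C = 1\<close> works.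
\<close>

lemma epowr_ennreal: "0 \<le> x \<Longrightarrow> epowr (ennreal x) a = ennreal (x powr a)"
  by (simp add: epowr_def)

lemma epowr_mono:
  assumes "x \<le> y" "0 \<le> a"
  shows "epowr x a \<le> epowr y a"
proof (cases "y = \<infinity>")
  \<comment> \<open>\<open>enn2real\<close> sends infinity to 0, so the comparison of real parts
    needs \<open>y\<close> finite, which makes \<open>x\<close> finite too.\<close>
  case False
  then have "y < top" "x < top"
    using assms by (auto simp: less_top[symmetric] top_unique)
  then show ?thesis
    using assms by (auto simp: epowr_def intro!: ennreal_leI powr_mono2 enn2real_mono)
qed (simp add: epowr_def)

text \<open>Young's inequality \<open>u \<le> u\<^bsup>c\<^esup> s\<^bsup>1-c\<^esup> / c + (1 - 1/c) s\<close>, cleared of its denominator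
  and extended to \<open>u = 0\<close>.\<close>

lemma powr_ge_tangent:
  fixes u s c :: real
  assumes "0 \<le> u" "0 < s" "1 \<le> c"
  shows "s powr c + c * s powr (c - 1) * (u - s) \<le> u powr c"
proof (cases "u = 0")
  \<comment> \<open>\<open>Youngs_inequality_0\<close> wants positive arguments. At
    \<open>u = 0\<close> the left side is \<open>(1 - c) * s powr c\<close>, which is at most
    0.\<close>
  case True
  have "s powr c = s powr (c - 1) * s"
    using assms by (simp add: powr_diff)
  with True assms show ?thesis
    by (simp add: algebra_simps mult_left_mono)
next
  case False
  with assms have u: "0 < u" by simp
  define t where "t = s powr (c - 1)"
  have t: "0 < t" and st: "s powr c = t * s"
    using assms by (simp_all add: t_def powr_diff)
  have "(u powr c / t) powr (1 / c) * s powr (1 - 1 / c)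
        \<le> (1 / c) * (u powr c / t) + (1 - 1 / c) * s"
    using assms u t by (intro Youngs_inequality_0) auto
  also have "(u powr c / t) powr (1 / c) * s powr (1 - 1 / c) = u"
    using assms u by (simp add: t_def powr_divide powr_powr diff_divide_distrib)
  finally have "u * (c * t) \<le> ((1 / c) * (u powr c / t) + (1 - 1 / c) * s) * (c * t)"
    using assms t by (intro mult_right_mono) auto
  also have "\<dots> = u powr c + (c - 1) * (t * s)"
    using assms t by (simp add: field_simps)
  finally show ?thesis
    unfolding st t_def[symmetric] by (simp add: algebra_simps)
qed

text \<open>Jensen for the power function: integrate the tangent bound at the mean \<open>s\<close>.
  The linear term has mean zero and the total mass is 1, so only \<open>s powr c\<close>
  survives.\<close>

lemma (in prob_space) expectation_powr_ge:
  fixes u :: "'a \<Rightarrow> real"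
  assumes u: "integrable M u" and uc: "integrable M (\<lambda>x. u x powr c)"
    and nonneg: "\<And>x. 0 \<le> u x" and c: "1 \<le> c"
  shows "expectation u powr c \<le> expectation (\<lambda>x. u x powr c)"
\<comment> \<open>The tangent point must be positive. A zero mean makes the left side
  \<open>0 powr c = 0\<close>.\<close>
proof (cases "expectation u = 0")
  case False
  define s where "s = expectation u"
  have "0 \<le> s"
    unfolding s_def by (simp add: nonneg)
  with False have s: "0 < s" by (simp add: s_def)
  have "expectation (\<lambda>x. s powr c + c * s powr (c - 1) * (u x - s)) \<le> expectation (\<lambda>x. u x powr c)"
    using u uc c s nonneg by (intro integral_mono powr_ge_tangent) auto
  moreover have "expectation (\<lambda>x. s powr c + c * s powr (c - 1) * (u x - s)) = s powr c"
    using u by (simp add: s_def prob_space)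
  ultimately show ?thesis by (simp add: s_def)
qed simp

lemma (in finite_measure) integrable_powr_bounded:
  fixes h :: "'a \<Rightarrow> real"
  assumes "h \<in> borel_measurable M" "AE x in M. \<bar>h x\<bar> \<le> m" "0 \<le> a"
  shows "integrable M (\<lambda>x. \<bar>h x\<bar> powr a)"
proof (rule integrable_const_bound)
  show "AE x in M. norm (\<bar>h x\<bar> powr a) \<le> m powr a"
    using assms(2) by eventually_elim (simp add: assms(3) powr_mono2)
qed (use assms(1) in measurable)

text \<open>In the integrable case the extended-real norm is a real number, so the interpolation can
  be computed with real powers.\<close>

lemma Lp_norm_eq:
  assumes "integrable M (\<lambda>x. \<bar>h x\<bar> powr a)"
  shows "Lp_norm M a h = ennreal ((\<integral>x. \<bar>h x\<bar> powr a \<partial>M) powr (1 / a))"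
  using assms by (simp add: Lp_norm_def nn_integral_eq_integral epowr_ennreal)

lemma (in prob_space) Lp_norm_interpolation:
  fixes h :: "'a \<Rightarrow> real"
  assumes h: "in_Linf M h" and p: "0 < p" and q: "0 < q"
  shows "Lp_norm M p h \<le> epowr (Linf_norm M h) (p / (q + p)) * epowr (Lp_norm M q h) (q / (q + p))"
proof -
  define m where "m = enn2real (Linf_norm M h)"
  have meas: "h \<in> borel_measurable M" and m: "Linf_norm M h = ennreal m" "0 \<le> m"
    using h by (auto simp: in_Linf_def m_def)
  have "AE x in M. ennreal \<bar>h x\<bar> \<le> Linf_norm M h"
    unfolding Linf_norm_def by (rule esssup_AE)
  then have bound: "AE x in M. \<bar>h x\<bar> \<le> m"
    by (simp add: m)
  note int = integrable_powr_bounded[OF meas bound]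
  define A where "A = (\<integral>x. \<bar>h x\<bar> powr p \<partial>M)"
  define B where "B = (\<integral>x. \<bar>h x\<bar> powr q \<partial>M)"
  have nonneg: "0 \<le> A" "0 \<le> B"
    by (simp_all add: A_def B_def)
  \<comment> \<open>Jensen is applied to \<bar>h\<bar>^p with exponent (q + p)/p, which is at least
    1.\<close>
  have "A powr ((q + p) / p) \<le> (\<integral>x. (\<bar>h x\<bar> powr p) powr ((q + p) / p) \<partial>M)"
    unfolding A_def using p q int by (intro expectation_powr_ge) (auto simp: powr_powr)
  also have "\<dots> = (\<integral>x. \<bar>h x\<bar> powr (q + p) \<partial>M)"
    using p by (simp add: powr_powr)
  also have "\<dots> \<le> (\<integral>x. m powr p * \<bar>h x\<bar> powr q \<partial>M)"
  proof (rule integral_mono_AE)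
    show "AE x in M. \<bar>h x\<bar> powr (q + p) \<le> m powr p * \<bar>h x\<bar> powr q"
      using bound
      by eventually_elim (use p in \<open>simp add: powr_add mult.commute mult_right_mono powr_mono2\<close>)
  qed (use p q int in auto)
  also have "\<dots> = m powr p * B"
    by (simp add: B_def)
  \<comment> \<open>Taking the (q + p)-th root turns the left side into the p-norm; on the right,
    1/(q + p) is split as (1/q) * (q/(q + p)) to expose the q-norm.\<close>
  finally have "(A powr ((q + p) / p)) powr (1 / (q + p)) \<le> (m powr p * B) powr (1 / (q + p))"
    using p q by (intro powr_mono2) auto
  then have "A powr (1 / p) \<le> m powr (p / (q + p)) * (B powr (1 / q)) powr (q / (q + p))"
    using p q m nonneg by (simp add: powr_powr powr_mult)
  then show ?thesis
    using p q m nonneg int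
    by (simp add: Lp_norm_eq epowr_ennreal ennreal_mult[symmetric] ennreal_leI A_def B_def)
qed

text \<open>By the pointwise triangle inequality the sum of the two norms is a finite
  almost-everywhere bound, hence dominates the essential supremum.\<close>

lemma in_Linf_diff:
  assumes "in_Linf M f" "in_Linf M g"
  shows "in_Linf M (\<lambda>x. f x - g x)"
proof -
  have [measurable]: "f \<in> borel_measurable M" "g \<in> borel_measurable M"
    using assms by (auto simp: in_Linf_def)
  have "AE x in M. ennreal \<bar>f x\<bar> \<le> Linf_norm M f" "AE x in M. ennreal \<bar>g x\<bar> \<le> Linf_norm M g"
    unfolding Linf_norm_def by (rule esssup_AE)+
  then have "AE x in M. ennreal \<bar>f x - g x\<bar> \<le> Linf_norm M f + Linf_norm M g"
  proof eventually_elim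
    case (elim x)
    have "ennreal \<bar>f x - g x\<bar> \<le> ennreal \<bar>f x\<bar> + ennreal \<bar>g x\<bar>"
      by (simp add: ennreal_plus[symmetric] ennreal_leI del: ennreal_plus)
    also have "\<dots> \<le> Linf_norm M f + Linf_norm M g"
      using elim by (rule add_mono)
    finally show ?case .
  qed
  then have "Linf_norm M (\<lambda>x. f x - g x) \<le> Linf_norm M f + Linf_norm M g"
    unfolding Linf_norm_def by (intro esssup_I) auto
  also have "\<dots> < \<infinity>"
    using assms by (simp add: in_Linf_def)
  finally show ?thesis by (simp add: in_Linf_def)
qed

lemma wasserstein_distr_le_Lp_norm:
  assumes [measurable]: "f \<in> borel_measurable M" "g \<in> borel_measurable M" and "0 < p"
  shows "wasserstein p (distr M borel f) (distr M borel g) \<le> Lp_norm M p (\<lambda>x. f x - g x)"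
proof -
  define \<gamma> where "\<gamma> = distr M (borel :: (real \<times> real) measure) (\<lambda>x. (f x, g x))"
  \<comment> \<open>On the plane the Borel sets are the product sigma-algebra, which makes the
    projections measurable.\<close>
  have [measurable]: "fst \<in> borel_measurable (borel :: (real \<times> real) measure)"
    "snd \<in> borel_measurable (borel :: (real \<times> real) measure)"
    by (simp_all add: borel_prod[symmetric])
  have "\<gamma> \<in> couplings (distr M borel f) (distr M borel g)"
    by (simp add: couplings_def \<gamma>_def distr_distr comp_def)
  then have "(INF \<gamma>\<in>couplings (distr M borel f) (distr M borel g).
      \<integral>\<^sup>+z. ennreal (\<bar>fst z - snd z\<bar> powr p) \<partial>\<gamma>) \<le> (\<integral>\<^sup>+z. ennreal (\<bar>fst z - snd z\<bar> powr p) \<partial>\<gamma>)"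
    by (rule INF_lower)
  also have "\<dots> = (\<integral>\<^sup>+x. ennreal (\<bar>f x - g x\<bar> powr p) \<partial>M)"
    by (simp add: \<gamma>_def nn_integral_distr)
  finally show ?thesis
    unfolding wasserstein_def Lp_norm_def using assms by (intro epowr_mono) auto
qed

theorem theorem3:
  fixes p q :: real
  assumes "p \<ge> 1" and "q \<ge> 1"
  shows "\<exists>C::real. C > 0 \<and>
    (\<forall>(d::nat) (\<Omega>::(nat \<Rightarrow> real) set) (\<rho>::(nat \<Rightarrow> real) measure)
       (f::(nat \<Rightarrow> real) \<Rightarrow> real) (g::(nat \<Rightarrow> real) \<Rightarrow> real).
       \<Omega> \<in> sets (euclidean_borel d) \<longrightarrow>
       euclidean_bounded d \<Omega> \<longrightarrow>
       prob_space \<rho> \<longrightarrow>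
       sets \<rho> = sets (restrict_space (euclidean_borel d) \<Omega>) \<longrightarrow>
       continuous_map (subtopology (Euclidean_space d) (Euclidean_space d closure_of \<Omega>)) euclideanreal f \<longrightarrow>
       continuous_map (subtopology (Euclidean_space d) (Euclidean_space d closure_of \<Omega>)) euclideanreal g \<longrightarrow>
       in_Linf \<rho> f \<longrightarrow> in_Lp \<rho> p f \<longrightarrow>
       in_Linf \<rho> g \<longrightarrow> in_Lp \<rho> p g \<longrightarrow>
       wasserstein p (distr \<rho> borel f) (distr \<rho> borel g)
         \<le> ennreal C * epowr (Linf_norm \<rho> (\<lambda>x. f x - g x)) (p / (q + p))
                     * epowr (Lp_norm \<rho> q (\<lambda>x. f x - g x)) (q / (q + p)))"
\<comment> \<open>Neither the coupling bound nor the interpolation loses a constant, so 1 serves for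
  every \<open>p\<close> and \<open>q\<close>.\<close>
proof (intro exI[of _ "1 :: real"] conjI allI impI)
  fix d \<Omega> \<rho> and f g :: "(nat \<Rightarrow> real) \<Rightarrow> real"
  assume "prob_space \<rho>" and f: "in_Linf \<rho> f" and g: "in_Linf \<rho> g"
  then interpret prob_space \<rho> by simp
  have "wasserstein p (distr \<rho> borel f) (distr \<rho> borel g) \<le> Lp_norm \<rho> p (\<lambda>x. f x - g x)"
    using f g assms by (intro wasserstein_distr_le_Lp_norm) (auto simp: in_Linf_def)
  also have "\<dots> \<le> epowr (Linf_norm \<rho> (\<lambda>x. f x - g x)) (p / (q + p))
      * epowr (Lp_norm \<rho> q (\<lambda>x. f x - g x)) (q / (q + p))"
    using f g assms by (intro Lp_norm_interpolation in_Linf_diff) auto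
  finally show "wasserstein p (distr \<rho> borel f) (distr \<rho> borel g)
      \<le> ennreal 1 * epowr (Linf_norm \<rho> (\<lambda>x. f x - g x)) (p / (q + p))
        * epowr (Lp_norm \<rho> q (\<lambda>x. f x - g x)) (q / (q + p))"
    by simp
qed simp

end
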